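(* Let $1\le m\le N$ be integers, let $u$ be an a.e. finite function on $\Lambda^m$ and let $U=G_{m,N}(u)$ be the generalized $N$-mean of order $m$ with kernel $u$. Then $U$ is measurable (with respect to $d^Nx$) if and only if $u$ is measurable (with respect to $d^mx$).
   Context: $\Lambda$ is a set with a $\sigma$-finite complete measure $dx$, of strictly positive total measure. For $k\ge 1$, $d^kx$ is the completion of the product measure $dx^{\otimes k}$ on $\Lambda^k$; "a.e.", "null set" and "measurable" on $\Lambda^k$ refer to $d^kx$. Functions are (extended) real-valued and defined a.e.; "a.e. finite" means finite-valued off a null set. No symmetry of the functions is assumed. For integers $1\le m\le N$ and an a.e. finite function $u$ on $\Lambda^m$, the generalized $N$-mean of order $m$ with kernel $u$ is the a.e. defined function on $\Lambda^N$ $$G_{m,N}(u)(x_1,\dots,x_N):=\binom{N}{m}^{-1}\sum_{1\le i_1<\cdots<i_m\le N}u(x_{i_1},\dots,x_{i_m}),$$ equality being understood a.e. on $\Lambda^N$. *)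

theory Defs
  imports "HOL-Analysis.Analysis"
begin

text \<open>The completed power measure; points of \<open>\<Lambda>\<^sup>k\<close> are extensional functions on \<open>{1..k}\<close>.\<close>

definition power_measure :: "'a measure \<Rightarrow> nat \<Rightarrow> (nat \<Rightarrow> 'a) measure" where
  "power_measure M k = completion (Pi\<^sub>M {1..k} (\<lambda>_. M))"

text \<open>Functions defined almost everywhere are modelled as total functions whose values on a null
  set are irrelevant. For a kernel that is finite almost everywhere, the convention for
  \<open>\<infinity> + (-\<infinity>)\<close> in \<^typ>\<open>ereal\<close> affects the mean only on a null set.\<close>

definition increasing_indices :: "nat \<Rightarrow> nat \<Rightarrow> (nat \<Rightarrow> nat) set" where
  "increasing_indices m N = {i \<in> {1..m} \<rightarrow>\<^sub>E {1..N}. strict_mono_on {1..m} i}"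

definition generalized_mean ::
    "nat \<Rightarrow> nat \<Rightarrow> ((nat \<Rightarrow> 'a) \<Rightarrow> ereal) \<Rightarrow> (nat \<Rightarrow> 'a) \<Rightarrow> ereal" where
  "generalized_mean m N u x =
     ereal (inverse (real (N choose m))) *
       (\<Sum>i\<in>increasing_indices m N. u (\<lambda>j\<in>{1..m}. x (i j)))"

end

theory Submission
  imports Defs
begin

text \<open>If \<open>U\<close> is measurable, evaluate it at all \<open>N\<close>-subsets of \<open>m + N\<close> points: for
  \<open>m \<le> N \<le> (m + N) - m\<close> the values of \<open>u\<close> at the \<open>m\<close>-subsets are linear combinations of these
  means, so \<open>u(x\<^sub>1, \<dots>, x\<^sub>m)\<close> is almost everywhere a measurable function on \<open>\<Lambda>\<^bsup>m+N\<^esup>\<close>;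
  fixing the last \<open>N\<close> variables generically shows that \<open>u\<close> is measurable. Subsets are
  always listed in increasing order, which makes symmetry of \<open>u\<close> unnecessary.\<close>

section \<open>Recovering a set function from its subset sums\<close>

text \<open>Pascal's rule at the level of subsets: \<open>T\<close> either avoids \<open>a\<close>
  or equals \<open>insert a R\<close> for exactly one \<open>R\<close>. Only the second sum depends
  on \<open>a\<close>, so the first cancels when two different points are compared.\<close>

lemma sum_card_subsets_insert:
  fixes f :: "'i set \<Rightarrow> 'c::comm_monoid_add"
  assumes "finite S" "a \<notin> S"
  shows "(\<Sum>T | T \<subseteq> insert a S \<and> card T = Suc m. f T) =
    (\<Sum>T | T \<subseteq> S \<and> card T = Suc m. f T) + (\<Sum>R | R \<subseteq> S \<and> card R = m. f (insert a R))"
proof -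
  have fin: "finite {R. R \<subseteq> S \<and> card R = k}" for k
    using assms by auto
  have "{T. T \<subseteq> insert a S \<and> card T = Suc m} =
      {T. T \<subseteq> S \<and> card T = Suc m} \<union> insert a ` {R. R \<subseteq> S \<and> card R = m}" (is "?L = ?A \<union> ?B")
  proof (intro equalityI subsetI)
    fix T assume T: "T \<in> ?L"
    show "T \<in> ?A \<union> ?B"
    proof (cases "a \<in> T")
      case True
      then have "T = insert a (T - {a})" "T - {a} \<subseteq> S" "card (T - {a}) = m"
        using T by auto
      then show ?thesis by blast
    qed (use T in auto)
  next
    fix T assume "T \<in> ?A \<union> ?B"
    then show "T \<in> ?L"
    proof
      assume "T \<in> ?B"
      then obtain R where R: "T = insert a R" "R \<subseteq> S" "card R = m" by auto
      then have "finite R" "a \<notin> R" using assms finite_subset by auto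
      with R show ?thesis by auto
    qed auto
  qed
  moreover have "?A \<inter> ?B = {}" using assms by auto
  moreover have "inj_on (insert a) {R. R \<subseteq> S \<and> card R = m}"
  proof (rule inj_onI)
    fix R R' assume "R \<in> {R. R \<subseteq> S \<and> card R = m}" "R' \<in> {R. R \<subseteq> S \<and> card R = m}"
      and "insert a R = insert a R'"
    moreover from this have "a \<notin> R" "a \<notin> R'" using assms by auto
    ultimately show "R = R'" by (simp add: insert_ident)
  qed
  ultimately show ?thesis
    using fin by (simp add: sum.union_disjoint sum.reindex)
qed

text \<open>Induction on \<open>m\<close>: comparing the sums over \<open>insert a S\<close> and \<open>insert b S\<close> shows, by the
  induction hypothesis for \<open>R \<mapsto> f (insert a R) - f (insert b R)\<close> on \<open>P - {a, b}\<close>, that exchanging one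
  element of a set changes \<open>f\<close> by a measurable function. So all \<open>f T\<close> agree up to measurable
  functions, and a single subset sum settles the question.\<close>

lemma borel_measurable_from_subset_sums:
  fixes f :: "'i set \<Rightarrow> 'b \<Rightarrow> real"
  assumes "finite P" "m \<le> N" "N + m \<le> card P"
    and "\<And>S. S \<subseteq> P \<Longrightarrow> card S = N \<Longrightarrow>
      (\<lambda>x. \<Sum>T | T \<subseteq> S \<and> card T = m. f T x) \<in> borel_measurable \<Omega>"
    and "T \<subseteq> P" "card T = m"
  shows "f T \<in> borel_measurable \<Omega>"
  using assms
proof (induction m arbitrary: N P f T)
  case 0
  obtain S where S: "S \<subseteq> P" "card S = N"
    using "0.prems"(3) by (metis add_0_right obtain_subset_with_card_n)
  then have "finite S" using 0 finite_subset by auto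
  then have "{T. T \<subseteq> S \<and> card T = 0} = {{}}"
    using finite_subset by (auto simp: card_eq_0_iff)
  moreover have "T = {}" using 0 finite_subset by (auto simp: card_eq_0_iff)
  ultimately show ?case using "0.prems"(4)[OF S] by simp
next
  case (Suc m)
  have "N > 0" using Suc.prems(2) by simp
  then obtain n where N: "N = Suc n" by (auto simp: gr0_conv_Suc)
  have finP: "finite S" if "S \<subseteq> P" for S using that Suc.prems(1) finite_subset by auto
  have exchange: "(\<lambda>x. f (insert a R) x - f (insert b R) x) \<in> borel_measurable \<Omega>"
    if ab: "a \<in> P" "b \<in> P" "a \<noteq> b" and R: "R \<subseteq> P - {a, b}" "card R = m" for a b R
  proof (rule Suc.IH[of "P - {a, b}" n "\<lambda>R x. f (insert a R) x - f (insert b R) x"])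
    \<comment> \<open>Passing to the smaller case lowers \<open>N\<close> and \<open>m\<close> by
      one each and costs the two points \<open>a\<close> and \<open>b\<close>, so the bound
      \<open>N + m \<le> card P\<close> is preserved.\<close>
    show "n + m \<le> card (P - {a, b})"
      using Suc.prems(1,3) N ab by (subst card_Diff_subset) auto
    fix S assume S: "S \<subseteq> P - {a, b}" "card S = n"
    then have fS: "finite S" "a \<notin> S" "b \<notin> S" using finP[of S] by auto
    let ?F = "\<lambda>c x. \<Sum>T | T \<subseteq> insert c S \<and> card T = Suc m. f T x"
    have "(\<lambda>x. ?F a x - ?F b x) \<in> borel_measurable \<Omega>"
      using S fS ab N by (intro borel_measurable_diff Suc.prems(4)) auto
    \<comment> \<open>The subsets of \<open>S\<close> itself contribute equally to
      \<open>?F a\<close> and \<open>?F b\<close>. What survives is the sum over the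
      \<open>m\<close>-subsets of \<open>S\<close> that the induction hypothesis asks for.\<close>
    moreover have "(\<lambda>x. ?F a x - ?F b x) =
        (\<lambda>x. \<Sum>R | R \<subseteq> S \<and> card R = m. f (insert a R) x - f (insert b R) x)"
      using fS by (simp add: sum_card_subsets_insert sum_subtractf)
    ultimately show "(\<lambda>x. \<Sum>R | R \<subseteq> S \<and> card R = m. f (insert a R) x - f (insert b R) x)
        \<in> borel_measurable \<Omega>"
      by simp
  qed (use Suc.prems N R in auto)
  have diff: "(\<lambda>x. f T x - f T' x) \<in> borel_measurable \<Omega>"
    if "T \<subseteq> P" "T' \<subseteq> P" "card T = Suc m" "card T' = Suc m" for T T'
    using that
  proof (induction "card (T - T')" arbitrary: T rule: less_induct)
    case less
    note fin = finP[OF less.prems(1)] finP[OF less.prems(2)]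
    show ?case
    proof (cases "T \<subseteq> T'")
      case True
      then have "T = T'" using less.prems fin by (intro card_subset_eq) auto
      then show ?thesis by simp
    next
      case False
      then obtain a where a: "a \<in> T" "a \<notin> T'" by auto
      have "\<not> T' \<subseteq> T" using less.prems fin card_subset_eq[of T T'] a by auto
      then obtain b where b: "b \<in> T'" "b \<notin> T" by auto
      \<comment> \<open>One exchange moves \<open>T\<close> closer to \<open>T'\<close>:
        \<open>a\<close> leaves the difference \<open>T - T'\<close>, and \<open>b\<close> does not
        enter it because it lies in \<open>T'\<close>.\<close>
      define T2 where "T2 = insert b (T - {a})"
      have T2: "T2 \<subseteq> P" "card T2 = Suc m"
        using a b less.prems fin by (auto simp: T2_def)
      have "T2 - T' \<subset> T - T'" using a b by (auto simp: T2_def)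
      then have "card (T2 - T') < card (T - T')"
        using fin by (intro psubset_card_mono) auto
      then have "(\<lambda>x. f T2 x - f T' x) \<in> borel_measurable \<Omega>"
        using less T2 by auto
      moreover have "(\<lambda>x. f (insert a (T - {a})) x - f (insert b (T - {a})) x) \<in> borel_measurable \<Omega>"
        using a b less.prems fin by (intro exchange) auto
      moreover have "insert a (T - {a}) = T" using a by auto
      ultimately have "(\<lambda>x. (f T x - f T2 x) + (f T2 x - f T' x)) \<in> borel_measurable \<Omega>"
        by (intro borel_measurable_add) (auto simp: T2_def)
      then show ?thesis by simp
    qed
  qed
  obtain S where S: "S \<subseteq> P" "card S = N"
    using Suc.prems(3) by (metis add_leD1 obtain_subset_with_card_n)
  let ?A = "{T. T \<subseteq> S \<and> card T = Suc m}"
  have "card ?A = N choose Suc m" using n_subsets[of S "Suc m"] finP[OF S(1)] S by simp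
  then have pos: "card ?A > 0" using Suc.prems(2) by simp
  \<comment> \<open>\<open>f T\<close> is its own average over \<open>?A\<close>. Adding and
    subtracting the \<open>f T'\<close> leaves measurable differences and one subset sum, which is
    measurable by hypothesis.\<close>
  have "(\<lambda>x. inverse (real (card ?A)) * ((\<Sum>T'\<in>?A. f T x - f T' x) + (\<Sum>T'\<in>?A. f T' x)))
      \<in> borel_measurable \<Omega>"
  proof (intro borel_measurable_times borel_measurable_add)
    show "(\<lambda>x. \<Sum>T'\<in>?A. f T x - f T' x) \<in> borel_measurable \<Omega>"
      using S Suc.prems by (intro borel_measurable_sum diff) auto
    show "(\<lambda>x. \<Sum>T'\<in>?A. f T' x) \<in> borel_measurable \<Omega>"
      using S by (rule Suc.prems(4))
  qed simp
  also have "(\<lambda>x. inverse (real (card ?A)) * ((\<Sum>T'\<in>?A. f T x - f T' x) + (\<Sum>T'\<in>?A. f T' x))) = f T"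
    using pos by (auto simp: sum_subtractf)
  finally show ?case .
qed

section \<open>Increasing enumerations\<close>

text \<open>Coordinates are numbered from 1 and list positions from 0, hence the shift. Only finite
  \<open>T\<close> and \<open>j\<close> in \<open>{1..card T}\<close> matter.\<close>

definition increasing_enum :: "nat set \<Rightarrow> nat \<Rightarrow> nat" where
  "increasing_enum T j = sorted_list_of_set T ! (j - 1)"

text \<open>A finite set has only one strictly increasing listing, so the list of the values of
  \<open>e\<close> must be it.\<close>

lemma increasing_enum_image:
  assumes "strict_mono_on {1..m} e" "j \<in> {1..m}"
  shows "increasing_enum (e ` {1..m}) j = e j"
proof -
  let ?l = "map e [1..<Suc m]"
  have "sorted_wrt (<) ?l"
    using assms(1) by (auto simp: sorted_wrt_iff_nth_less strict_mono_on_def simp del: upt_Suc)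
  moreover have "set ?l = e ` {1..m}"
    by (auto simp del: upt_Suc)
  ultimately have "sorted_list_of_set (e ` {1..m}) = ?l"
    by (metis strict_sorted_equal strict_sorted_list_of_set set_sorted_list_of_set List.finite_set)
  then show ?thesis
    using assms(2) by (auto simp: increasing_enum_def simp del: upt_Suc)
qed

lemma increasing_enum:
  assumes "finite T" "card T = m"
  shows "strict_mono_on {1..m} (increasing_enum T)"
    and "increasing_enum T ` {1..m} = T"
proof -
  show "strict_mono_on {1..m} (increasing_enum T)"
    using assms strict_sorted_list_of_set[of T]
    by (auto simp: strict_mono_on_def increasing_enum_def sorted_wrt_iff_nth_less)
  have "increasing_enum T ` {1..m} = (\<lambda>j. sorted_list_of_set T ! j) ` {0..<m}"
  proof -
    have "{0..<m} = (\<lambda>j. j - 1) ` {1..m}"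
      by (force simp: image_iff intro: bexI[of _ "Suc _"])
    then show ?thesis by (auto simp: increasing_enum_def image_image)
  qed
  also have "\<dots> = set (sorted_list_of_set T)"
    using assms by (auto simp: set_conv_nth)
  finally show "increasing_enum T ` {1..m} = T"
    using assms by simp
qed

lemma strict_mono_on_compose_increasing_indices:
  assumes s: "strict_mono_on {1..N} s" and i: "i \<in> increasing_indices m N"
  shows "strict_mono_on {1..m} (\<lambda>j. s (i j))"
proof (rule strict_mono_onI)
  fix j k assume jk: "j \<in> {1..m}" "k \<in> {1..m}" "j < k"
  then have "i j < i k" "i j \<in> {1..N}" "i k \<in> {1..N}"
    using i by (auto simp: increasing_indices_def strict_mono_on_def)
  then show "s (i j) < s (i k)"
    using s by (auto simp: strict_mono_on_def)
qed

text \<open>The image set determines \<open>s \<circ> i\<close> as its increasing enumeration, and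
  \<open>s\<close> is injective, so it determines \<open>i\<close>. Conversely, the enumeration of
  \<open>T\<close> pulls back along \<open>s\<close>, and the pullback is increasing because
  \<open>s\<close> reflects the order.\<close>

lemma bij_betw_increasing_indices:
  fixes s :: "nat \<Rightarrow> nat"
  assumes s: "strict_mono_on {1..N} s"
  shows "bij_betw (\<lambda>i. (\<lambda>j. s (i j)) ` {1..m}) (increasing_indices m N)
    {T. T \<subseteq> s ` {1..N} \<and> card T = m}"
proof -
  have inj: "inj_on s {1..N}" using s by (rule strict_mono_on_imp_inj_on)
  have range: "i j \<in> {1..N}" if "i \<in> increasing_indices m N" "j \<in> {1..m}" for i j
    using that by (auto simp: increasing_indices_def)
  note mono = strict_mono_on_compose_increasing_indices[OF s]
  show ?thesis
  proof (intro bij_betw_imageI inj_onI equalityI subsetI)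
    fix i i' assume i: "i \<in> increasing_indices m N" "i' \<in> increasing_indices m N"
      and eq: "(\<lambda>j. s (i j)) ` {1..m} = (\<lambda>j. s (i' j)) ` {1..m}"
    show "i = i'"
    proof (rule PiE_ext)
      show "i \<in> {1..m} \<rightarrow>\<^sub>E {1..N}" "i' \<in> {1..m} \<rightarrow>\<^sub>E {1..N}"
        using i by (auto simp: increasing_indices_def)
      fix j assume j: "j \<in> {1..m}"
      then have "s (i j) = s (i' j)"
        using increasing_enum_image[OF mono[OF i(1)] j] increasing_enum_image[OF mono[OF i(2)] j] eq
        by simp
      then show "i j = i' j"
        using inj range[OF i(1) j] range[OF i(2) j] by (auto dest: inj_onD)
    qed
  next
    fix T assume "T \<in> (\<lambda>i. (\<lambda>j. s (i j)) ` {1..m}) ` increasing_indices m N"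
    then obtain i where i: "i \<in> increasing_indices m N" "T = (\<lambda>j. s (i j)) ` {1..m}" by auto
    then have "card T = m"
      using card_image[OF strict_mono_on_imp_inj_on[OF mono[OF i(1)]]] by simp
    then show "T \<in> {T. T \<subseteq> s ` {1..N} \<and> card T = m}"
      using range i by auto
  next
    fix T assume "T \<in> {T. T \<subseteq> s ` {1..N} \<and> card T = m}"
    then have T: "T \<subseteq> s ` {1..N}" "card T = m" "finite T"
      by (auto intro: finite_subset)
    let ?e = "increasing_enum T"
    note e = increasing_enum[OF T(3,2)]
    define i where "i = (\<lambda>j\<in>{1..m}. inv_into {1..N} s (?e j))"
    have si: "i j \<in> {1..N}" "s (i j) = ?e j" if "j \<in> {1..m}" for j
    proof -
      have "?e j \<in> s ` {1..N}" using that e T by auto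
      then show "i j \<in> {1..N}" "s (i j) = ?e j"
        using that by (simp_all add: i_def f_inv_into_f inv_into_into del: atLeastAtMost_iff)
    qed
    have "i j < i k" if jk: "j \<in> {1..m}" "k \<in> {1..m}" "j < k" for j k
    proof (rule ccontr)
      assume "\<not> i j < i k"
      then have "s (i k) \<le> s (i j)"
        using s si(1)[OF jk(1)] si(1)[OF jk(2)] strict_mono_on_leD[OF s] by auto
      then show False
        using jk si(2)[OF jk(1)] si(2)[OF jk(2)] strict_mono_onD[OF e(1) jk] by simp
    qed
    then have "i \<in> increasing_indices m N"
      using si(1) by (auto simp: increasing_indices_def strict_mono_on_def i_def)
    moreover have "T = (\<lambda>j. s (i j)) ` {1..m}"
      using e(2) si(2) by (metis image_cong)
    ultimately show "T \<in> (\<lambda>i. (\<lambda>j. s (i j)) ` {1..m}) ` increasing_indices m N"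
      by blast
  qed
qed

text \<open>Links the two descriptions of a mean: the sum over index tuples at the \<open>N\<close>
  points selected by \<open>s\<close> becomes a sum over the \<open>m\<close>-subsets of the
  selected indices. On both sides \<open>v\<close> sees its arguments in increasing order of
  index.\<close>

lemma sum_increasing_indices:
  fixes v :: "(nat \<Rightarrow> 'a) \<Rightarrow> 'c::comm_monoid_add"
  assumes s: "strict_mono_on {1..N} s"
  shows "(\<Sum>T | T \<subseteq> s ` {1..N} \<and> card T = m. v (\<lambda>j\<in>{1..m}. x (increasing_enum T j))) =
    (\<Sum>i\<in>increasing_indices m N. v (\<lambda>j\<in>{1..m}. (\<lambda>k\<in>{1..N}. x (s k)) (i j)))"
proof -
  have "v (\<lambda>j\<in>{1..m}. x (increasing_enum ((\<lambda>j. s (i j)) ` {1..m}) j)) =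
      v (\<lambda>j\<in>{1..m}. (\<lambda>k\<in>{1..N}. x (s k)) (i j))" if i: "i \<in> increasing_indices m N" for i
  proof -
    have range: "i j \<in> {1..N}" if "j \<in> {1..m}" for j
      using that i by (auto simp: increasing_indices_def)
    have "strict_mono_on {1..m} (\<lambda>j. s (i j))"
      using s i by (rule strict_mono_on_compose_increasing_indices)
    then have "(\<lambda>j\<in>{1..m}. x (increasing_enum ((\<lambda>j. s (i j)) ` {1..m}) j)) =
        (\<lambda>j\<in>{1..m}. (\<lambda>k\<in>{1..N}. x (s k)) (i j))"
      using range increasing_enum_image by (intro restrict_ext) fastforce
    then show ?thesis by simp
  qed
  then show ?thesis
    by (subst sum.reindex_bij_betw[OF bij_betw_increasing_indices[OF s], symmetric])
       (rule sum.cong, auto)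
qed

section \<open>Completed product measures\<close>

text \<open>The preimages of a set under \<open>f\<close> and \<open>g\<close> differ only inside a
  null set, and completeness makes every subset of a null set measurable.\<close>

lemma (in complete_measure) measurable_AE_cong:
  assumes f: "f \<in> M \<rightarrow>\<^sub>M N" and g: "\<And>x. x \<in> space M \<Longrightarrow> g x \<in> space N"
    and ae: "AE x in M. f x = g x"
  shows "g \<in> M \<rightarrow>\<^sub>M N"
proof (rule measurableI)
  fix A assume "A \<in> sets N"
  then show "g -` A \<inter> space M \<in> sets M"
    using ae by (intro in_sets_AE[OF _ measurable_sets[OF f]]) auto
qed (fact g)

lemma borel_measurable_completion_AE_cong_iff:
  assumes "AE x in completion M. f x = g x"
  shows "f \<in> borel_measurable (completion M) \<longleftrightarrow> g \<in> borel_measurable (completion M)"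
proof
  show "g \<in> borel_measurable (completion M)" if "f \<in> borel_measurable (completion M)"
    using completion.measurable_AE_cong[OF that _ assms] by simp
  have "AE x in completion M. g x = f x" using assms by eventually_elim simp
  then show "f \<in> borel_measurable (completion M)" if "g \<in> borel_measurable (completion M)"
    using completion.measurable_AE_cong[OF that, of f] by simp
qed

text \<open>Passing to real values makes subtraction available for the recovery from subset sums.
  Infinite values become 0, which happens only on a null set.\<close>

lemma borel_measurable_completion_AE_finite_iff:
  fixes u :: "'b \<Rightarrow> ereal"
  assumes "AE x in completion M. \<bar>u x\<bar> \<noteq> \<infinity>"
  shows "u \<in> borel_measurable (completion M) \<longleftrightarrow>
    (\<lambda>x. real_of_ereal (u x)) \<in> borel_measurable (completion M)"
proof -
  have "AE x in completion M. u x = ereal (real_of_ereal (u x))"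
    using assms by eventually_elim (auto simp: ereal_real)
  then show ?thesis
    by (subst borel_measurable_completion_AE_cong_iff) (auto simp: borel_measurable_ereal_iff)
qed

section \<open>Coordinate maps between finite powers of a sigma-finite measure\<close>

context
  fixes M :: "'a measure"
  assumes sigma_finite: "sigma_finite_measure M"
begin

interpretation product_sigma_finite "\<lambda>_. M"
  using sigma_finite by (simp add: product_sigma_finite_def)

text \<open>A product measure is determined by its values on boxes. Renaming coordinates pulls a box
  back to a box with the same factors, relabelled.\<close>

lemma distr_PiM_reindex_bij:
  assumes K: "finite K" and e: "inj_on e K"
  shows "distr (Pi\<^sub>M (e ` K) (\<lambda>_. M)) (Pi\<^sub>M K (\<lambda>_. M)) (\<lambda>x. \<lambda>j\<in>K. x (e j)) = Pi\<^sub>M K (\<lambda>_. M)"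
proof (rule PiM_eqI[OF K])
  fix A assume A: "\<And>j. j \<in> K \<Longrightarrow> A j \<in> sets M"
  have meas: "(\<lambda>x. \<lambda>j\<in>K. x (e j)) \<in> Pi\<^sub>M (e ` K) (\<lambda>_. M) \<rightarrow>\<^sub>M Pi\<^sub>M K (\<lambda>_. M)"
    by (intro measurable_restrict measurable_component_singleton) auto
  let ?B = "\<lambda>k. A (inv_into K e k)"
  have sub: "x \<in> space M" if "j \<in> K" "x \<in> A j" for j x
    using A[OF that(1)] that(2) sets.sets_into_space by blast
  have "(\<lambda>x. \<lambda>j\<in>K. x (e j)) -` Pi\<^sub>E K A \<inter> space (Pi\<^sub>M (e ` K) (\<lambda>_. M)) = Pi\<^sub>E (e ` K) ?B"
    using e by (auto simp: space_PiM PiE_iff intro: sub)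
  then have "emeasure (distr (Pi\<^sub>M (e ` K) (\<lambda>_. M)) (Pi\<^sub>M K (\<lambda>_. M)) (\<lambda>x. \<lambda>j\<in>K. x (e j))) (Pi\<^sub>E K A)
      = emeasure (Pi\<^sub>M (e ` K) (\<lambda>_. M)) (Pi\<^sub>E (e ` K) ?B)"
    using meas A K by (subst emeasure_distr) (auto intro!: sets_PiM_I_finite)
  also have "\<dots> = (\<Prod>k\<in>e ` K. emeasure M (?B k))"
    using A K e by (intro emeasure_PiM) auto
  also have "\<dots> = (\<Prod>j\<in>K. emeasure M (A j))"
    using e by (simp add: prod.reindex)
  finally show "emeasure (distr (Pi\<^sub>M (e ` K) (\<lambda>_. M)) (Pi\<^sub>M K (\<lambda>_. M)) (\<lambda>x. \<lambda>j\<in>K. x (e j))) (Pi\<^sub>E K A)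
      = (\<Prod>j\<in>K. emeasure M (A j))" .
qed simp

text \<open>The preimage of \<open>A\<close> is the cylinder over \<open>A\<close>, identified
  through \<open>merge\<close> with a product set. Only null sets are compared: if \<open>M\<close>
  is not a probability measure, the projection need not carry one power to the other.\<close>

lemma null_sets_distr_restrict:
  assumes "finite L" "I \<subseteq> L"
  shows "null_sets (Pi\<^sub>M I (\<lambda>_. M)) \<subseteq>
    null_sets (distr (Pi\<^sub>M L (\<lambda>_. M)) (Pi\<^sub>M I (\<lambda>_. M)) (\<lambda>x. restrict x I))"
proof
  fix A assume A: "A \<in> null_sets (Pi\<^sub>M I (\<lambda>_. M))"
  define J where "J = L - I"
  have IJ: "I \<inter> J = {}" "finite I" "finite J" "I \<union> J = L"
    using assms by (auto simp: J_def intro: finite_subset)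
  interpret J: sigma_finite_measure "Pi\<^sub>M J (\<lambda>_. M)"
    using IJ by (intro sigma_finite)
  have L: "distr (Pi\<^sub>M I (\<lambda>_. M) \<Otimes>\<^sub>M Pi\<^sub>M J (\<lambda>_. M)) (Pi\<^sub>M L (\<lambda>_. M)) (merge I J) = Pi\<^sub>M L (\<lambda>_. M)"
    using distr_merge[OF IJ(1-3)] IJ by simp
  have merge: "merge I J \<in> Pi\<^sub>M I (\<lambda>_. M) \<Otimes>\<^sub>M Pi\<^sub>M J (\<lambda>_. M) \<rightarrow>\<^sub>M Pi\<^sub>M L (\<lambda>_. M)"
    using measurable_merge[of I J "\<lambda>_. M"] IJ by simp
  have res: "(\<lambda>x. restrict x I) \<in> Pi\<^sub>M L (\<lambda>_. M) \<rightarrow>\<^sub>M Pi\<^sub>M I (\<lambda>_. M)"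
    using assms by (intro measurable_restrict_subset)
  have sets: "A \<in> sets (Pi\<^sub>M I (\<lambda>_. M))" and zero: "emeasure (Pi\<^sub>M I (\<lambda>_. M)) A = 0"
    using A by auto
  let ?V = "(\<lambda>x. restrict x I) -` A \<inter> space (Pi\<^sub>M L (\<lambda>_. M))"
  have V: "?V \<in> sets (Pi\<^sub>M L (\<lambda>_. M))" using res sets by (rule measurable_sets)
  have "emeasure (Pi\<^sub>M L (\<lambda>_. M)) ?V =
      emeasure (Pi\<^sub>M I (\<lambda>_. M) \<Otimes>\<^sub>M Pi\<^sub>M J (\<lambda>_. M))
        (merge I J -` ?V \<inter> space (Pi\<^sub>M I (\<lambda>_. M) \<Otimes>\<^sub>M Pi\<^sub>M J (\<lambda>_. M)))"
    by (subst L[symmetric]) (rule emeasure_distr[OF merge V])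
  also have "merge I J -` ?V \<inter> space (Pi\<^sub>M I (\<lambda>_. M) \<Otimes>\<^sub>M Pi\<^sub>M J (\<lambda>_. M)) =
      A \<times> space (Pi\<^sub>M J (\<lambda>_. M))"
  proof (intro equalityI subsetI)
    fix z assume "z \<in> merge I J -` ?V \<inter> space (Pi\<^sub>M I (\<lambda>_. M) \<Otimes>\<^sub>M Pi\<^sub>M J (\<lambda>_. M))"
    then show "z \<in> A \<times> space (Pi\<^sub>M J (\<lambda>_. M))"
      using IJ(1) by (cases z) (auto simp: space_pair_measure space_PiM PiE_restrict)
  next
    fix z assume z: "z \<in> A \<times> space (Pi\<^sub>M J (\<lambda>_. M))"
    then have sp: "z \<in> space (Pi\<^sub>M I (\<lambda>_. M) \<Otimes>\<^sub>M Pi\<^sub>M J (\<lambda>_. M))"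
      using sets.sets_into_space[OF sets] by (auto simp: space_pair_measure)
    then show "z \<in> merge I J -` ?V \<inter> space (Pi\<^sub>M I (\<lambda>_. M) \<Otimes>\<^sub>M Pi\<^sub>M J (\<lambda>_. M))"
      using z measurable_space[OF merge sp] IJ(1)
      by (cases z) (auto simp: space_pair_measure space_PiM PiE_restrict)
  qed
  \<comment> \<open>The second factor may have infinite measure; the product is still 0 since 0
    times infinity is 0 here.\<close>
  also have "emeasure (Pi\<^sub>M I (\<lambda>_. M) \<Otimes>\<^sub>M Pi\<^sub>M J (\<lambda>_. M)) (A \<times> space (Pi\<^sub>M J (\<lambda>_. M))) = 0"
    using zero sets by (simp add: J.emeasure_pair_measure_Times)
  finally show "A \<in> null_sets (distr (Pi\<^sub>M L (\<lambda>_. M)) (Pi\<^sub>M I (\<lambda>_. M)) (\<lambda>x. restrict x I))"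
    unfolding null_sets_distr_iff[OF res] using sets V null_setsI by blast
qed

lemma measurable_completion_reindex:
  assumes L: "finite L" and e: "inj_on e K" "e ` K \<subseteq> L"
  shows "(\<lambda>x. \<lambda>j\<in>K. x (e j)) \<in> completion (Pi\<^sub>M L (\<lambda>_. M)) \<rightarrow>\<^sub>M completion (Pi\<^sub>M K (\<lambda>_. M))"
    and "AE x in completion (Pi\<^sub>M K (\<lambda>_. M)). P x \<Longrightarrow>
      AE x in completion (Pi\<^sub>M L (\<lambda>_. M)). P (\<lambda>j\<in>K. x (e j))"
proof -
  let ?r = "\<lambda>x. \<lambda>j\<in>K. x (e j)" and ?I = "e ` K"
  have K: "finite K" using L e finite_imageD finite_subset by metis
  have r: "?r \<in> Pi\<^sub>M L (\<lambda>_. M) \<rightarrow>\<^sub>M Pi\<^sub>M K (\<lambda>_. M)"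
    and rI: "?r \<in> Pi\<^sub>M ?I (\<lambda>_. M) \<rightarrow>\<^sub>M Pi\<^sub>M K (\<lambda>_. M)"
    and res: "(\<lambda>x. restrict x ?I) \<in> Pi\<^sub>M L (\<lambda>_. M) \<rightarrow>\<^sub>M Pi\<^sub>M ?I (\<lambda>_. M)"
    using e by (auto intro!: measurable_restrict measurable_component_singleton measurable_restrict_subset)
  have null: "?r -` A \<inter> space (Pi\<^sub>M L (\<lambda>_. M)) \<in> null_sets (Pi\<^sub>M L (\<lambda>_. M))"
    if "A \<in> null_sets (Pi\<^sub>M K (\<lambda>_. M))" for A
  proof -
    have "A \<in> null_sets (distr (Pi\<^sub>M ?I (\<lambda>_. M)) (Pi\<^sub>M K (\<lambda>_. M)) ?r)"
      using that distr_PiM_reindex_bij[OF K e(1)] by simp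
    then have "?r -` A \<inter> space (Pi\<^sub>M ?I (\<lambda>_. M)) \<in> null_sets (Pi\<^sub>M ?I (\<lambda>_. M))"
      by (simp add: null_sets_distr_iff[OF rI])
    then have "?r -` A \<inter> space (Pi\<^sub>M ?I (\<lambda>_. M)) \<in>
        null_sets (distr (Pi\<^sub>M L (\<lambda>_. M)) (Pi\<^sub>M ?I (\<lambda>_. M)) (\<lambda>x. restrict x ?I))"
      using null_sets_distr_restrict[OF L e(2)] by blast
    then have "(\<lambda>x. restrict x ?I) -` (?r -` A \<inter> space (Pi\<^sub>M ?I (\<lambda>_. M))) \<inter> space (Pi\<^sub>M L (\<lambda>_. M))
        \<in> null_sets (Pi\<^sub>M L (\<lambda>_. M))"
      by (simp add: null_sets_distr_iff[OF res])
    also have "(\<lambda>x. restrict x ?I) -` (?r -` A \<inter> space (Pi\<^sub>M ?I (\<lambda>_. M))) \<inter> space (Pi\<^sub>M L (\<lambda>_. M))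
        = ?r -` A \<inter> space (Pi\<^sub>M L (\<lambda>_. M))"
      using measurable_space[OF res] by (auto cong: restrict_cong)
    finally show ?thesis .
  qed
  have sub: "null_sets (Pi\<^sub>M K (\<lambda>_. M)) \<subseteq>
      null_sets (distr (completion (Pi\<^sub>M L (\<lambda>_. M))) (Pi\<^sub>M K (\<lambda>_. M)) ?r)"
    unfolding distr_completion[OF r]
    using null by (auto simp: null_sets_distr_iff[OF r])
  show "?r \<in> completion (Pi\<^sub>M L (\<lambda>_. M)) \<rightarrow>\<^sub>M completion (Pi\<^sub>M K (\<lambda>_. M))"
    using sub by (intro completion.measurable_completion2 measurable_completion r)
  assume "AE x in completion (Pi\<^sub>M K (\<lambda>_. M)). P x"
  then obtain A where A: "A \<in> null_sets (Pi\<^sub>M K (\<lambda>_. M))" "{x \<in> space (Pi\<^sub>M K (\<lambda>_. M)). \<not> P x} \<subseteq> A"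
    unfolding AE_completion_iff by (auto simp: eventually_ae_filter)
  then show "AE x in completion (Pi\<^sub>M L (\<lambda>_. M)). P (?r x)"
    unfolding AE_completion_iff
    using measurable_space[OF r] by (intro AE_I'[OF null[OF A(1)]]) auto
qed

text \<open>A Fubini argument: the function of \<open>x\<close> agrees almost everywhere with a
  measurable \<open>h\<close>. For a generic choice \<open>y\<close> of the coordinates outside
  \<open>I\<close>, the section of \<open>h\<close> at \<open>y\<close> is measurable and equals
  \<open>g\<close> almost everywhere.\<close>

lemma borel_measurable_completion_restrictD:
  fixes g :: "('i \<Rightarrow> 'a) \<Rightarrow> real"
  assumes pos: "emeasure M (space M) > 0" and L: "finite L" "I \<subseteq> L"
    and g: "(\<lambda>x. g (restrict x I)) \<in> borel_measurable (completion (Pi\<^sub>M L (\<lambda>_. M)))"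
  shows "g \<in> borel_measurable (completion (Pi\<^sub>M I (\<lambda>_. M)))"
proof -
  define J where "J = L - I"
  have IJ: "J \<inter> I = {}" "finite J" "finite I" "J \<union> I = L"
    using L by (auto simp: J_def intro: finite_subset)
  interpret I: sigma_finite_measure "Pi\<^sub>M I (\<lambda>_. M)" using IJ by (intro sigma_finite)
  interpret J: sigma_finite_measure "Pi\<^sub>M J (\<lambda>_. M)" using IJ by (intro sigma_finite)
  interpret pair_sigma_finite "Pi\<^sub>M J (\<lambda>_. M)" "Pi\<^sub>M I (\<lambda>_. M)" ..
  have merge: "merge J I \<in> Pi\<^sub>M J (\<lambda>_. M) \<Otimes>\<^sub>M Pi\<^sub>M I (\<lambda>_. M) \<rightarrow>\<^sub>M Pi\<^sub>M L (\<lambda>_. M)"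
    using measurable_merge[of J I "\<lambda>_. M"] IJ by simp
  \<comment> \<open>Since \<open>h\<close> is measurable for the product before completion, each of
    its sections is measurable.\<close>
  obtain h where h: "h \<in> borel_measurable (Pi\<^sub>M L (\<lambda>_. M))"
    and ae: "AE x in Pi\<^sub>M L (\<lambda>_. M). g (restrict x I) = h x"
    using completion_ex_borel_measurable_real[OF g] by auto
  have "distr (Pi\<^sub>M J (\<lambda>_. M) \<Otimes>\<^sub>M Pi\<^sub>M I (\<lambda>_. M)) (Pi\<^sub>M L (\<lambda>_. M)) (merge J I) = Pi\<^sub>M L (\<lambda>_. M)"
    using distr_merge[OF IJ(1-3)] IJ(4) by simp
  then have "AE x in distr (Pi\<^sub>M J (\<lambda>_. M) \<Otimes>\<^sub>M Pi\<^sub>M I (\<lambda>_. M)) (Pi\<^sub>M L (\<lambda>_. M)) (merge J I).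
      g (restrict x I) = h x"
    using ae by (rule ssubst)
  then have "AE z in Pi\<^sub>M J (\<lambda>_. M) \<Otimes>\<^sub>M Pi\<^sub>M I (\<lambda>_. M). g (restrict (merge J I z) I) = h (merge J I z)"
    by (rule AE_distrD[OF merge])
  then have aeJ: "AE y in Pi\<^sub>M J (\<lambda>_. M). AE x in Pi\<^sub>M I (\<lambda>_. M).
      g (restrict (merge J I (y, x)) I) = h (merge J I (y, x))" (is "AE y in _. ?Q y")
    by (rule AE_pair)
  \<comment> \<open>Positive total mass of \<open>M\<close> is what guarantees that a good
    \<open>y\<close> exists: on a space of measure zero a property could hold almost everywhere and
    nowhere.\<close>
  have nonnull: "emeasure (Pi\<^sub>M J (\<lambda>_. M)) (space (Pi\<^sub>M J (\<lambda>_. M))) \<noteq> 0"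
    using pos IJ(2) by (simp add: space_PiM emeasure_PiM zero_less_iff_neq_zero)
  have "\<exists>y\<in>space (Pi\<^sub>M J (\<lambda>_. M)). ?Q y"
  proof (rule ccontr)
    assume none: "\<not> ?thesis"
    have "AE y in Pi\<^sub>M J (\<lambda>_. M). False"
      by (rule AE_mp[OF aeJ AE_I2]) (use none in blast)
    then show False
      using nonnull AE_iff_measurable[of "space (Pi\<^sub>M J (\<lambda>_. M))" "Pi\<^sub>M J (\<lambda>_. M)" "\<lambda>_. False"] by simp
  qed
  then obtain y where y: "y \<in> space (Pi\<^sub>M J (\<lambda>_. M))"
    and aey: "AE x in Pi\<^sub>M I (\<lambda>_. M). g (restrict (merge J I (y, x)) I) = h (merge J I (y, x))"
    by blast
  have meas: "(\<lambda>x. h (merge J I (y, x))) \<in> borel_measurable (Pi\<^sub>M I (\<lambda>_. M))"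
    using measurable_compose[OF measurable_Pair1'[OF y] measurable_compose[OF merge h]] by simp
  have "AE x in Pi\<^sub>M I (\<lambda>_. M). h (merge J I (y, x)) = g x"
    using aey
  proof (rule AE_mp, intro AE_I2 impI)
    fix x assume "x \<in> space (Pi\<^sub>M I (\<lambda>_. M))"
      and eq: "g (restrict (merge J I (y, x)) I) = h (merge J I (y, x))"
    then have "restrict (merge J I (y, x)) I = x"
      using IJ by (auto simp: space_PiM PiE_restrict)
    with eq show "h (merge J I (y, x)) = g x" by simp
  qed
  from borel_measurable_completion_AE_cong_iff[OF AE_completion[OF this]]
  show ?thesis
    using measurable_completion[OF meas] by simp
qed

end

section \<open>Kernels and means\<close>

text \<open>When all summands are finite, the sum is one of real numbers and no convention for
  opposite infinities intervenes.\<close>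

lemma generalized_mean_eq_real:
  assumes "\<And>i. i \<in> increasing_indices m N \<Longrightarrow> \<bar>u (\<lambda>j\<in>{1..m}. x (i j))\<bar> \<noteq> \<infinity>"
  shows "generalized_mean m N u x = ereal (inverse (real (N choose m)) *
    (\<Sum>i\<in>increasing_indices m N. real_of_ereal (u (\<lambda>j\<in>{1..m}. x (i j)))))"
proof -
  have "(\<Sum>i\<in>increasing_indices m N. u (\<lambda>j\<in>{1..m}. x (i j))) =
      (\<Sum>i\<in>increasing_indices m N. ereal (real_of_ereal (u (\<lambda>j\<in>{1..m}. x (i j)))))"
    using assms by (intro sum.cong) (auto simp: ereal_real)
  then show ?thesis by (simp add: generalized_mean_def)
qed

lemma finite_increasing_indices: "finite (increasing_indices m N)"
  unfolding increasing_indices_def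
  by (rule finite_subset[of _ "{1..m} \<rightarrow>\<^sub>E {1..N}"]) (auto intro: finite_PiE)

theorem theorem5:
  fixes M :: "'a measure" and m N :: nat
    and u U :: "(nat \<Rightarrow> 'a) \<Rightarrow> ereal"
  assumes "sigma_finite_measure M" and "complete_measure M"
    and "emeasure M (space M) > 0"
    and "1 \<le> m" and "m \<le> N"
    and "AE x in power_measure M m. \<bar>u x\<bar> \<noteq> \<infinity>"
    and "AE x in power_measure M N. U x = generalized_mean m N u x"
  shows "U \<in> borel_measurable (power_measure M N) \<longleftrightarrow>
         u \<in> borel_measurable (power_measure M m)"
proof -
  define v where "v = (\<lambda>x. real_of_ereal (u x))"
  define V where "V = (\<lambda>x. \<Sum>i\<in>increasing_indices m N. v (\<lambda>j\<in>{1..m}. x (i j)))"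
  define c where "c = real (N choose m)"
  have c: "c \<noteq> 0" using assms(5) by (simp add: c_def)
  note reindex = measurable_completion_reindex(1)[OF assms(1)]
  have inj: "inj_on i {1..m}" "i ` {1..m} \<subseteq> {1..N}" if "i \<in> increasing_indices m N" for i
    using that by (auto simp: increasing_indices_def intro: strict_mono_on_imp_inj_on)
  \<comment> \<open>Each index tuple is injective, so the null set where \<open>u\<close> is
    infinite pulls back to a null set. There are finitely many tuples.\<close>
  have "AE x in power_measure M N. \<forall>i\<in>increasing_indices m N. \<bar>u (\<lambda>j\<in>{1..m}. x (i j))\<bar> \<noteq> \<infinity>"
    unfolding power_measure_def
    by (intro AE_finite_allI finite_increasing_indices measurable_completion_reindex(2)[OF assms(1)]
        assms(6)[unfolded power_measure_def] inj) auto
  with assms(7) have UV: "AE x in power_measure M N. U x = ereal (inverse c * V x)"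
  proof eventually_elim
    case (elim x)
    then show ?case
      using generalized_mean_eq_real[of m N u x] by (simp add: V_def v_def c_def)
  qed
  have U_iff: "U \<in> borel_measurable (power_measure M N) \<longleftrightarrow> V \<in> borel_measurable (power_measure M N)"
  proof -
    have "U \<in> borel_measurable (power_measure M N) \<longleftrightarrow>
        (\<lambda>x. inverse c * V x) \<in> borel_measurable (power_measure M N)"
      using borel_measurable_completion_AE_cong_iff[OF UV[unfolded power_measure_def]]
      by (simp add: borel_measurable_ereal_iff power_measure_def)
    also have "\<dots> \<longleftrightarrow> V \<in> borel_measurable (power_measure M N)"
    proof
      \<comment> \<open>The binomial factor \<open>c\<close> is nonzero because
        \<open>m \<le> N\<close>, so the normalisation can be undone.\<close>
      assume "(\<lambda>x. inverse c * V x) \<in> borel_measurable (power_measure M N)"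
      then have "(\<lambda>x. c * (inverse c * V x)) \<in> borel_measurable (power_measure M N)"
        by (rule borel_measurable_times[OF borel_measurable_const])
      moreover have "(\<lambda>x. c * (inverse c * V x)) = V"
        using c by (simp add: fun_eq_iff)
      ultimately show "V \<in> borel_measurable (power_measure M N)"
        by (simp only:)
    qed auto
    finally show ?thesis .
  qed
  have u_iff: "u \<in> borel_measurable (power_measure M m) \<longleftrightarrow> v \<in> borel_measurable (power_measure M m)"
    using assms(6) unfolding power_measure_def v_def
    by (rule borel_measurable_completion_AE_finite_iff)
  have "V \<in> borel_measurable (power_measure M N)" if v: "v \<in> borel_measurable (power_measure M m)"
    unfolding V_def
  proof (rule borel_measurable_sum)
    fix i assume i: "i \<in> increasing_indices m N"
    show "(\<lambda>x. v (\<lambda>j\<in>{1..m}. x (i j))) \<in> borel_measurable (power_measure M N)"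
      using measurable_compose[OF reindex[OF _ inj[OF i]] v[unfolded power_measure_def]]
      by (simp add: power_measure_def)
  qed
  moreover have "v \<in> borel_measurable (power_measure M m)" if V: "V \<in> borel_measurable (power_measure M N)"
  proof -
    let ?P = "{1..m + N}" and ?f = "\<lambda>T x. v (\<lambda>j\<in>{1..m}. x (increasing_enum T j))"
    have "?f {1..m} \<in> borel_measurable (power_measure M (m + N))"
    proof (rule borel_measurable_from_subset_sums[of ?P m N ?f])
      fix S assume S: "S \<subseteq> ?P" "card S = N"
      then have "finite S" using finite_subset by auto
      note e = increasing_enum[OF this S(2)]
      \<comment> \<open>Selecting the \<open>N\<close> coordinates in \<open>S\<close> is a
        coordinate map along the enumeration of \<open>S\<close>. It is measurable between the
        completed powers, so composing it with \<open>V\<close> preserves measurability.\<close>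
      have "(\<lambda>x. V (\<lambda>k\<in>{1..N}. x (increasing_enum S k))) \<in> borel_measurable (power_measure M (m + N))"
        using measurable_compose[OF reindex[of ?P, OF _ strict_mono_on_imp_inj_on[OF e(1)]]
            V[unfolded power_measure_def]] e(2) S(1)
        by (simp add: power_measure_def)
      then show "(\<lambda>x. \<Sum>T | T \<subseteq> S \<and> card T = m. ?f T x) \<in> borel_measurable (power_measure M (m + N))"
        using sum_increasing_indices[OF e(1), where m = m and v = v] e(2) by (simp add: V_def)
    qed (use assms in auto)
    \<comment> \<open>The set \<open>{1..m}\<close> is enumerated by the identity, so its
      \<open>?f\<close> is \<open>v\<close> at the first \<open>m\<close> coordinates; the other
      \<open>N\<close> are dummies for the section argument.\<close>
    moreover have "(\<lambda>j\<in>{1..m}. x (increasing_enum {1..m} j)) = restrict x {1..m}" for x :: "nat \<Rightarrow> 'a"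
      using increasing_enum_image[of m "\<lambda>j. j"]
      by (intro restrict_ext) (auto simp: strict_mono_on_def)
    ultimately have res: "(\<lambda>x. v (restrict x {1..m})) \<in> borel_measurable (power_measure M (m + N))"
      by (simp only:)
    show ?thesis
      unfolding power_measure_def
      by (rule borel_measurable_completion_restrictD[OF assms(1,3) _ _ res[unfolded power_measure_def]])
        auto
  qed
  ultimately show ?thesis
    using U_iff u_iff by blast
qed

end
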